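(* Let $\mathbf{B}=(b_{jk})$ be the $6\times 6$ skew-symmetric exchange matrix and $\Phi$ the assignment of functions of positive variables $\mathbf{y}=(y_1,\dots,y_6)$ to the symbols $\mathbb{k}_1,\mathbb{k}_2,\mathbb{k}_3,\mathbb{k}_{1,2},\mathbb{k}_{2,3},\mathbb{k}_{1,2,3},\mathbb{b}_1,\mathbb{b}_2$ given in the context, and let $\mathscr{D}_1^{cl},\mathscr{D}_2^{cl},\mathscr{D}_3^{cl}$ be the classical Dehn twists given in the context. Consider the compositions of cluster mutations and vertex relabelings $$M_1=\sigma_{3,5}\,\mu_2\mu_3\mu_2,\qquad M_2=\sigma_{3,6}\,\mu_1\mu_6\mu_1,\qquad M_3=\sigma_{4,6}\,\mu_2\mu_4\mu_2 .$$ Then each $M_a$ ($a=1,2,3$) preserves the exchange matrix $\mathbf{B}$, and it acts on the variables by $\mathbf{y}\mapsto M_a(\mathbf{y})$ with $$M_1(\mathbf{y})=\Bigl(\tfrac{y_1y_2y_3}{1+y_2+y_2y_3},\ \tfrac{1+y_2+y_2y_3}{y_3},\ (1+y_3)(1+y_2+y_2y_3)y_5,\ \tfrac{y_2(1+y_3)y_4}{1+y_2+y_2y_3},\ \tfrac{1}{y_2(1+y_3)},\ \tfrac{y_3y_6}{1+y_3}\Bigr),$$ $$M_2(\mathbf{y})=\Bigl(\tfrac{1+y_1+y_1y_6}{y_6},\ \tfrac{y_1y_2y_6}{1+y_1+y_1y_6},\ \tfrac{1}{y_1(1+y_6)},\ \tfrac{y_4y_6}{1+y_6},\ \tfrac{y_1y_5(1+y_6)}{1+y_1+y_1y_6},\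 y_3(1+y_6)(1+y_1+y_1y_6)\Bigr),$$ $$M_3(\mathbf{y})=\Bigl(\tfrac{y_1y_2y_4}{1+y_2+y_2y_4},\ \tfrac{1+y_2+y_2y_4}{y_4},\ \tfrac{y_2y_3(1+y_4)}{1+y_2+y_2y_4},\ (1+y_4)(1+y_2+y_2y_4)y_6,\ \tfrac{y_4y_5}{1+y_4},\ \tfrac{1}{y_2(1+y_4)}\Bigr).$$ Moreover the classical Dehn twists are induced by these mutations: for every $a\in\{1,2,3\}$ and every generator $\mathbb{g}\in\{\mathbb{k}_1,\mathbb{k}_2,\mathbb{k}_3,\mathbb{k}_{1,2},\mathbb{k}_{2,3},\mathbb{k}_{1,2,3},\mathbb{b}_1,\mathbb{b}_2\}$, $$\Phi(\mathbb{g})\bigl(M_a(\mathbf{y})\bigr)=\Phi\bigl(\mathscr{D}_a^{cl}(\mathbb{g})\bigr)(\mathbf{y}),$$ where $\Phi$ is extended multiplicatively and additively to polynomials in the generators.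
   Context: **Exchange matrix.** $$\mathbf{B}=\begin{pmatrix}0&0&-1&-1&1&1\\0&0&1&1&-1&-1\\1&-1&0&0&-1&1\\1&-1&0&0&1&-1\\-1&1&1&-1&0&0\\-1&1&-1&1&0&0\end{pmatrix}.$$ **Mutation.** $\mu_k(\mathbf{y},\mathbf{B})=(\widetilde{\mathbf{y}},\widetilde{\mathbf{B}})$ with $\widetilde y_k=y_k^{-1}$; for $i\ne k$, $\widetilde y_i=y_i(1+y_k^{-1})^{-b_{ki}}$ if $b_{ki}\ge0$ and $\widetilde y_i=y_i(1+y_k)^{-b_{ki}}$ if $b_{ki}\le0$; $\widetilde b_{ij}=-b_{ij}$ if $i=k$ or $j=k$, and $\widetilde b_{ij}=b_{ij}+\tfrac12(|b_{ik}|b_{kj}+b_{ik}|b_{kj}|)$ otherwise. In a composition $\mu_i\mu_j\mu_i$ each mutation uses the exchange matrix produced by the previous one, starting from $(\mathbf{y},\mathbf{B})$. $\sigma_{i,j}$ is the relabeling exchanging the vertices $i$ and $j$ (exchanging the entries $y_i,y_j$ and the rows and columns $i,j$ of the matrix), applied after the mutations. **The functions $\Phi$** (trace map for the twice-punctured torus; positive square roots): - $\Phi(\mathbb{k}_1)=\sqrt{y_2y_3y_5}+\sqrt{\tfrac{y_2y_5}{y_3}}+\sqrt{\tfrac{y_5}{y_2y_3}}+\tfrac{1}{\sqrt{y_2y_3y_5}}$ - $\Phi(\mathbb{k}_2)=\sqrt{y_1y_3y_6}+\sqrt{\tfrac{y_1y_3}{y_6}}+\sqrt{\tfrac{y_3}{y_1y_6}}+\tfrac{1}{\sqrt{y_1y_3y_6}}$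 - $\Phi(\mathbb{k}_3)=\sqrt{y_2y_4y_6}+\sqrt{\tfrac{y_2y_6}{y_4}}+\sqrt{\tfrac{y_6}{y_2y_4}}+\tfrac{1}{\sqrt{y_2y_4y_6}}$ - $\Phi(\mathbb{k}_{1,2,3})=\sqrt{y_1y_4y_5}+\sqrt{\tfrac{y_1y_4}{y_5}}+\sqrt{\tfrac{y_4}{y_1y_5}}+\tfrac{1}{\sqrt{y_1y_4y_5}}$ - $\Phi(\mathbb{k}_{1,2})=\sqrt{y_1y_2y_5y_6}+\sqrt{\tfrac{y_1y_5y_6}{y_2}}+\sqrt{\tfrac{y_1y_5}{y_2y_6}}+\sqrt{\tfrac{y_1y_6}{y_2y_5}}+\sqrt{\tfrac{y_1}{y_2y_5y_6}}+\tfrac{1}{\sqrt{y_1y_2y_5y_6}}$ - $\Phi(\mathbb{k}_{2,3})=\sqrt{y_1y_2y_3y_4}+\sqrt{\tfrac{y_2y_3y_4}{y_1}}+\sqrt{\tfrac{y_2y_3}{y_1y_4}}+\sqrt{\tfrac{y_2y_4}{y_1y_3}}+\sqrt{\tfrac{y_2}{y_1y_3y_4}}+\tfrac{1}{\sqrt{y_1y_2y_3y_4}}$ - $\Phi(\mathbb{b}_1)=\sqrt{y_3y_4y_5y_6}+\tfrac{1}{\sqrt{y_3y_4y_5y_6}}$, $\quad\Phi(\mathbb{b}_2)=y_1y_2\sqrt{y_3y_4y_5y_6}+\tfrac{1}{y_1y_2\sqrt{y_3y_4y_5y_6}}$ **Classical Dehn twists.** On $(\mathbb{k}_1,\mathbb{k}_2,\mathbb{k}_3,\mathbb{k}_{1,2},\mathbb{k}_{2,3},\mathbb{k}_{1,2,3})$,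 with $\mathbb{b}_1,\mathbb{b}_2$ fixed by all three: - $\mathscr{D}_1^{cl}\mapsto(\mathbb{k}_1,\ \mathbb{k}_1\mathbb{k}_2-\mathbb{k}_{1,2},\ \mathbb{k}_3,\ \mathbb{k}_2,\ \mathbb{k}_1\mathbb{k}_{2,3}-\mathbb{k}_{1,2,3},\ \mathbb{k}_{2,3})$ - $\mathscr{D}_2^{cl}\mapsto(\mathbb{k}_{1,2},\ \mathbb{k}_2,\ \mathbb{k}_2\mathbb{k}_3-\mathbb{k}_{2,3},\ \mathbb{k}_2\mathbb{k}_{1,2}-\mathbb{k}_1,\ \mathbb{k}_3,\ \mathbb{k}_{1,2,3})$ - $\mathscr{D}_3^{cl}\mapsto(\mathbb{k}_1,\ \mathbb{k}_{2,3},\ \mathbb{k}_3,\ \mathbb{k}_{1,2,3},\ \mathbb{k}_3\mathbb{k}_{2,3}-\mathbb{k}_2,\ \mathbb{k}_3\mathbb{k}_{1,2,3}-\mathbb{k}_{1,2})$ *)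

theory Defs
  imports "HOL-Analysis.Analysis" "HOL-Library.Poly_Mapping"
begin

type_synonym 'n seed = "(real^'n) \<times> (int^'n^'n)"

text \<open>
  The vertices are the elements \<open>1, 2, 3, 4, 5, 6\<close> of the numeral type \<open>6\<close>, in which \<open>6 = 0\<close>.
  The entry \<open>b_jk\<close> is \<open>B $ j $ k\<close>: an exchange matrix is the vector of its rows.
\<close>

definition exchange_matrix :: "int^6^6" where
  "exchange_matrix = vector
     [vector [ 0,  0, -1, -1,  1,  1],
      vector [ 0,  0,  1,  1, -1, -1],
      vector [ 1, -1,  0,  0, -1,  1],
      vector [ 1, -1,  0,  0,  1, -1],
      vector [-1,  1,  1, -1,  0,  0],
      vector [-1,  1, -1,  1,  0,  0]]"

text \<open>The integer division by \<open>2\<close> is exact: see \<open>mutation_term_even\<close> below.\<close>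

definition mutation :: "'n::finite \<Rightarrow> 'n seed \<Rightarrow> 'n seed" where
  "mutation k = (\<lambda>(y, B).
     (\<chi> i. if i = k then inverse (y $ k)
           else if B $ k $ i \<ge> 0 then y $ i * (1 + inverse (y $ k)) powi (- (B $ k $ i))
           else y $ i * (1 + y $ k) powi (- (B $ k $ i)),
      \<chi> i j. if i = k \<or> j = k then - (B $ i $ j)
             else B $ i $ j
               + (\<bar>B $ i $ k\<bar> * B $ k $ j + B $ i $ k * \<bar>B $ k $ j\<bar>) div 2))"

lemma mutation_term_even: "even (\<bar>a\<bar> * b + a * \<bar>b\<bar>)" for a b :: int
  by (auto simp: abs_if)

definition relabel :: "'n::finite \<Rightarrow> 'n \<Rightarrow> 'n seed \<Rightarrow> 'n seed" where
  "relabel i j = (\<lambda>(y, B).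
     (\<chi> k. y $ Transposition.transpose i j k,
      \<chi> k l. B $ Transposition.transpose i j k $ Transposition.transpose i j l))"

definition M1 :: "6 seed \<Rightarrow> 6 seed" where
  "M1 = relabel 3 5 \<circ> mutation 2 \<circ> mutation 3 \<circ> mutation 2"

definition M2 :: "6 seed \<Rightarrow> 6 seed" where
  "M2 = relabel 3 6 \<circ> mutation 1 \<circ> mutation 6 \<circ> mutation 1"

definition M3 :: "6 seed \<Rightarrow> 6 seed" where
  "M3 = relabel 4 6 \<circ> mutation 2 \<circ> mutation 4 \<circ> mutation 2"

datatype gen = K1 | K2 | K3 | K12 | K23 | K123 | B1 | B2

lemma UNIV_gen: "UNIV = {K1, K2, K3, K12, K23, K123, B1, B2}"
  by (auto intro: gen.exhaust)

instance gen :: finite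
  by standard (simp add: UNIV_gen)

fun Phi :: "gen \<Rightarrow> real^6 \<Rightarrow> real" where
  "Phi K1 y = sqrt (y$2 * y$3 * y$5) + sqrt (y$2 * y$5 / y$3)
     + sqrt (y$5 / (y$2 * y$3)) + 1 / sqrt (y$2 * y$3 * y$5)"
| "Phi K2 y = sqrt (y$1 * y$3 * y$6) + sqrt (y$1 * y$3 / y$6)
     + sqrt (y$3 / (y$1 * y$6)) + 1 / sqrt (y$1 * y$3 * y$6)"
| "Phi K3 y = sqrt (y$2 * y$4 * y$6) + sqrt (y$2 * y$6 / y$4)
     + sqrt (y$6 / (y$2 * y$4)) + 1 / sqrt (y$2 * y$4 * y$6)"
| "Phi K123 y = sqrt (y$1 * y$4 * y$5) + sqrt (y$1 * y$4 / y$5)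
     + sqrt (y$4 / (y$1 * y$5)) + 1 / sqrt (y$1 * y$4 * y$5)"
| "Phi K12 y = sqrt (y$1 * y$2 * y$5 * y$6) + sqrt (y$1 * y$5 * y$6 / y$2)
     + sqrt (y$1 * y$5 / (y$2 * y$6)) + sqrt (y$1 * y$6 / (y$2 * y$5))
     + sqrt (y$1 / (y$2 * y$5 * y$6)) + 1 / sqrt (y$1 * y$2 * y$5 * y$6)"
| "Phi K23 y = sqrt (y$1 * y$2 * y$3 * y$4) + sqrt (y$2 * y$3 * y$4 / y$1)
     + sqrt (y$2 * y$3 / (y$1 * y$4)) + sqrt (y$2 * y$4 / (y$1 * y$3))
     + sqrt (y$2 / (y$1 * y$3 * y$4)) + 1 / sqrt (y$1 * y$2 * y$3 * y$4)"
| "Phi B1 y = sqrt (y$3 * y$4 * y$5 * y$6) + 1 / sqrt (y$3 * y$4 * y$5 * y$6)"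
| "Phi B2 y = y$1 * y$2 * sqrt (y$3 * y$4 * y$5 * y$6)
     + 1 / (y$1 * y$2 * sqrt (y$3 * y$4 * y$5 * y$6))"

text \<open>
  Polynomials with integer coefficients in the eight generators: finitely supported maps from
  monomials (exponent vectors) to coefficients, with the convolution product.
\<close>

type_synonym gen_poly = "(gen \<Rightarrow>\<^sub>0 nat) \<Rightarrow>\<^sub>0 int"

definition X :: "gen \<Rightarrow> gen_poly" where
  "X g = Poly_Mapping.single (Poly_Mapping.single g 1) 1"

text \<open>The extension of \<open>Phi\<close> to a ring homomorphism, as the lemmas below show.\<close>

definition Phi_poly :: "gen_poly \<Rightarrow> real^6 \<Rightarrow> real" where
  "Phi_poly p y = (\<Sum>m\<in>Poly_Mapping.keys p.
     of_int (Poly_Mapping.lookup p m) * (\<Prod>g\<in>UNIV. Phi g y ^ Poly_Mapping.lookup m g))"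

lemma Phi_poly_superset:
  assumes "finite S" "Poly_Mapping.keys p \<subseteq> S"
  shows "Phi_poly p y = (\<Sum>m\<in>S.
     of_int (Poly_Mapping.lookup p m) * (\<Prod>g\<in>UNIV. Phi g y ^ Poly_Mapping.lookup m g))"
  unfolding Phi_poly_def using assms
  by (intro sum.mono_neutral_left) (auto simp: in_keys_iff)

lemma Phi_poly_single:
  "Phi_poly (Poly_Mapping.single m c) y
     = of_int c * (\<Prod>g\<in>UNIV. Phi g y ^ Poly_Mapping.lookup m g)"
  by (subst Phi_poly_superset[of "{m}"]) auto

lemma Phi_poly_X: "Phi_poly (X g) y = Phi g y"
proof -
  have "(\<Prod>h\<in>UNIV. Phi h y ^ Poly_Mapping.lookup (Poly_Mapping.single g 1) h)
      = (\<Prod>h\<in>UNIV. if h = g then Phi h y else 1)"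
    by (intro prod.cong) (auto simp: lookup_single when_def)
  then show ?thesis by (simp add: X_def Phi_poly_single)
qed

lemma Phi_poly_one: "Phi_poly 1 y = 1"
  by (simp add: Phi_poly_single flip: single_one)

lemma Phi_poly_add: "Phi_poly (p + q) y = Phi_poly p y + Phi_poly q y"
proof -
  let ?S = "Poly_Mapping.keys p \<union> Poly_Mapping.keys q"
  have "Poly_Mapping.keys (p + q) \<subseteq> ?S" by (rule keys_add)
  then show ?thesis
    by (simp add: Phi_poly_superset[of ?S] lookup_add ring_distribs sum.distrib)
qed

lemma Phi_poly_mult: "Phi_poly (p * q) y = Phi_poly p y * Phi_poly q y"
proof -
  have zero: "Phi_poly 0 y = 0" by (simp add: Phi_poly_def)
  have mono: "Phi_poly (Poly_Mapping.single m c * Poly_Mapping.single n d) y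
      = Phi_poly (Poly_Mapping.single m c) y * Phi_poly (Poly_Mapping.single n d) y" for m n c d
    by (simp add: mult_single Phi_poly_single lookup_add power_add prod.distrib)
  have single: "Phi_poly (Poly_Mapping.single m c * q) y
      = Phi_poly (Poly_Mapping.single m c) y * Phi_poly q y" for m c q
  proof (induction q rule: update_induct)
    case const
    then show ?case by (simp add: zero)
  next
    case (update q n d)
    have "Poly_Mapping.update n d q = Poly_Mapping.single n d + q"
      using update by (intro poly_mapping_eqI)
        (auto simp: lookup_update lookup_add lookup_single in_keys_iff when_def)
    then show ?case by (simp add: distrib_left Phi_poly_add mono update)
  qed
  show ?thesis
  proof (induction p rule: update_induct)
    case const
    then show ?case by (simp add: zero)
  next
    case (update p n d)
    have "Poly_Mapping.update n d p = Poly_Mapping.single n d + p"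
      using update by (intro poly_mapping_eqI)
        (auto simp: lookup_update lookup_add lookup_single in_keys_iff when_def)
    then show ?case by (simp add: distrib_right Phi_poly_add single update)
  qed
qed

text \<open>The classical Dehn twists.\<close>

fun D1 :: "gen \<Rightarrow> gen_poly" where
  "D1 K1 = X K1"
| "D1 K2 = X K1 * X K2 - X K12"
| "D1 K3 = X K3"
| "D1 K12 = X K2"
| "D1 K23 = X K1 * X K23 - X K123"
| "D1 K123 = X K23"
| "D1 B1 = X B1"
| "D1 B2 = X B2"

fun D2 :: "gen \<Rightarrow> gen_poly" where
  "D2 K1 = X K12"
| "D2 K2 = X K2"
| "D2 K3 = X K2 * X K3 - X K23"
| "D2 K12 = X K2 * X K12 - X K1"
| "D2 K23 = X K3"
| "D2 K123 = X K123"
| "D2 B1 = X B1"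
| "D2 B2 = X B2"

fun D3 :: "gen \<Rightarrow> gen_poly" where
  "D3 K1 = X K1"
| "D3 K2 = X K23"
| "D3 K3 = X K3"
| "D3 K12 = X K123"
| "D3 K23 = X K3 * X K23 - X K2"
| "D3 K123 = X K3 * X K123 - X K12"
| "D3 B1 = X B1"
| "D3 B2 = X B2"

end

theory Submission
  imports Defs
begin

text \<open>
  Only \<open>M1\<close> has to be computed. The permutation \<open>rot\<close> of the six vertices, of order four, preserves
  the exchange matrix; it carries the vertex sequence of \<open>M1\<close> to that of \<open>M2\<close> and the sequence of
  \<open>M2\<close> to that of \<open>M3\<close>; and precomposing with it permutes the functions \<open>Phi g\<close>, through the
  4-cycle \<open>K1, K2, K3, K123\<close> and the swap of \<open>K12\<close> and \<open>K23\<close> (\<open>Phi_rot\<close>). Under this permutation of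
  the generators \<open>D1\<close> becomes \<open>D2\<close> and \<open>D2\<close> becomes \<open>D3\<close>. Since mutation is natural in the vertex
  set (\<open>mutation_permute\<close>, \<open>relabel_permute\<close>), all claims about \<open>M2\<close> follow from those about \<open>M1\<close>,
  and all claims about \<open>M3\<close> from those about \<open>M2\<close>.

  For \<open>M1\<close> the three mutations are carried out one at a time (\<open>M1_seed\<close>); the polynomials that
  survive in the result are \<open>S = 1 + y\<^sub>2 + y\<^sub>2 y\<^sub>3\<close> and \<open>T = 1 + y\<^sub>3\<close>. In terms of the square roots of
  the \<open>y\<^sub>i\<close>, of \<open>S\<close> and of \<open>T\<close> every \<open>Phi g\<close>, evaluated at \<open>y\<close> or at the image of \<open>y\<close>, is a Laurent
  polynomial in which the roots of \<open>S\<close> and \<open>T\<close> have even exponents. Replacing their squares by \<open>S\<close>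
  and \<open>T\<close> turns the claim for each generator into an identity of rational functions in the square
  roots of the \<open>y\<^sub>i\<close> (\<open>Phi_M1\<close>). A typical one is that of \<open>K1\<close>: the first three terms of \<open>Phi K1\<close> add
  up to \<open>S\<close> times a monomial, and this product is a single term of \<open>Phi K1\<close> at the image, while the
  fourth term is recovered as the sum of the other three.
\<close>

section \<open>Vectors indexed by six vertices\<close>

lemma exhaust_6:
  fixes i :: 6
  shows "i = 1 \<or> i = 2 \<or> i = 3 \<or> i = 4 \<or> i = 5 \<or> i = 6"
proof (induct i)
  case (of_int z)
  then have "z = 0 \<or> z = 1 \<or> z = 2 \<or> z = 3 \<or> z = 4 \<or> z = 5" by auto
  then show ?case by auto
qed

lemma forall_6: "(\<forall>i::6. P i) \<longleftrightarrow> P 1 \<and> P 2 \<and> P 3 \<and> P 4 \<and> P 5 \<and> P 6"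
  by (metis exhaust_6)

lemma vector_6 [simp]:
  "(vector [a, b, c, d, e, f] :: 'a::zero^6) $ 1 = a"
  "(vector [a, b, c, d, e, f] :: 'a::zero^6) $ 2 = b"
  "(vector [a, b, c, d, e, f] :: 'a::zero^6) $ 3 = c"
  "(vector [a, b, c, d, e, f] :: 'a::zero^6) $ 4 = d"
  "(vector [a, b, c, d, e, f] :: 'a::zero^6) $ 5 = e"
  "(vector [a, b, c, d, e, f] :: 'a::zero^6) $ 6 = f"
  by (simp_all add: vector_def eq_numeral_iff_iszero)

section \<open>The first composition of mutations\<close>

text \<open>
  The exchange matrix changes at every step and returns to its original value only after the final
  relabeling, so the intermediate seeds are recorded in full. The cancellations between
  steps come from \<open>S + b = (1 + a) (1 + b)\<close>, where \<open>S = 1 + a + a b\<close>, by which the factor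
  \<open>1 + a\<close> introduced by the first mutation is removed by the third.
\<close>

lemma M1_seed:
  fixes y :: "real^6"
  assumes pos: "\<And>i. y $ i > 0"
  shows "M1 (y, exchange_matrix) = (vector
       [y$1 * y$2 * y$3 / (1 + y$2 + y$2 * y$3),
        (1 + y$2 + y$2 * y$3) / y$3,
        (1 + y$3) * (1 + y$2 + y$2 * y$3) * y$5,
        y$2 * (1 + y$3) * y$4 / (1 + y$2 + y$2 * y$3),
        1 / (y$2 * (1 + y$3)),
        y$3 * y$6 / (1 + y$3)], exchange_matrix)"
proof -
  define a where "a = y$2"
  define b where "b = y$3"
  have ab: "a > 0" "b > 0" using pos unfolding a_def b_def by auto
  define S where "S = 1 + a + a * b"
  have S: "S > 0" using ab unfolding S_def by (simp add: add_pos_pos)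
  \<comment> \<open>The binomials of the second and of the third mutation, whose pivots are \<open>a b / (1 + a)\<close> and
    \<open>b / S\<close>.\<close>
  have factors3: "1 + a * b / (1 + a) = S / (1 + a)" "1 + (1 + a) / (a * b) = S / (a * b)"
      "1 + a + a * b = S" "a * b + (1 + a) = S"
    and factors2: "1 + b / S = (1 + a) * (1 + b) / S" "1 + S / b = (1 + a) * (1 + b) / b"
      "(1 + a) * (1 + b) = b + S" "(1 + b) * (1 + a) = b + S" "S + b = b + S"
    using ab S by (simp_all add: S_def field_simps)
  have "mutation 2 (y, exchange_matrix) = (vector
     [y$1, 1 / a, a * b / (1 + a), a * y$4 / (1 + a), (1 + a) * y$5, (1 + a) * y$6],
    vector
     [vector [ 0,  0, -1, -1,  1,  1],
      vector [ 0,  0, -1, -1,  1,  1],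
      vector [ 1,  1,  0,  0, -2,  0],
      vector [ 1,  1,  0,  0,  0, -2],
      vector [-1, -1,  2,  0,  0,  0],
      vector [-1, -1,  0,  2,  0,  0]])" (is "_ = ?seed1")
    using ab unfolding prod_eq_iff vec_eq_iff forall_6 exchange_matrix_def
    by (simp add: mutation_def eq_numeral_iff_iszero power_int_minus field_simps
        flip: a_def b_def)
  moreover have "mutation 3 ?seed1 = (vector
     [a * b * y$1 / S, b / S, (1 + a) / (a * b), a * y$4 / (1 + a),
      S\<^sup>2 * y$5 / (1 + a), (1 + a) * y$6],
    vector
     [vector [ 0,  0,  1, -1, -1,  1],
      vector [ 0,  0,  1, -1, -1,  1],
      vector [-1, -1,  0,  0,  2,  0],
      vector [ 1,  1,  0,  0,  0, -2],
      vector [ 1,  1, -2,  0,  0,  0],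
      vector [-1, -1,  0,  2,  0,  0]])" (is "_ = ?seed2")
    using ab S unfolding prod_eq_iff vec_eq_iff forall_6
    by (simp add: mutation_def eq_numeral_iff_iszero power_int_minus factors3
        divide_simps power2_eq_square)
  moreover have "mutation 2 ?seed2 = (vector
     [a * b * y$1 / S, S / b, 1 / (a * (1 + b)), a * (1 + b) * y$4 / S,
      (1 + b) * S * y$5, b * y$6 / (1 + b)],
    vector
     [vector [ 0,  0,  1, -1, -1,  1],
      vector [ 0,  0, -1,  1,  1, -1],
      vector [-1,  1,  0, -1,  1,  0],
      vector [ 1, -1,  1,  0,  0, -1],
      vector [ 1, -1, -1,  0,  0,  1],
      vector [-1,  1,  0,  1, -1,  0]])" (is "_ = ?seed3")
    using ab S unfolding prod_eq_iff vec_eq_iff forall_6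
    by (simp add: mutation_def eq_numeral_iff_iszero power_int_minus factors2
        divide_simps power2_eq_square)
  moreover have "relabel 3 5 ?seed3 = (vector
     [a * b * y$1 / S, S / b, (1 + b) * S * y$5, a * (1 + b) * y$4 / S,
      1 / (a * (1 + b)), b * y$6 / (1 + b)],
     exchange_matrix)"
    unfolding prod_eq_iff vec_eq_iff forall_6 exchange_matrix_def
    by (simp add: relabel_def Transposition.transpose_def eq_numeral_iff_iszero)
  ultimately show ?thesis
    by (simp add: M1_def S_def a_def b_def mult_ac)
qed

section \<open>The first Dehn twist\<close>

lemma Phi_poly_diff: "Phi_poly (p - q) y = Phi_poly p y - Phi_poly q y"
  using Phi_poly_add[of "p - q" q y] by simp

text \<open>
  Passing to the square roots \<open>x i\<close>, \<open>s\<close>, \<open>t\<close> makes all values of \<open>Phi\<close> rational expressions, in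
  which \<open>s\<close> and \<open>t\<close> can be eliminated because they enter through their squares only.
\<close>

lemma Phi_M1:
  fixes y :: "real^6"
  assumes pos: "\<And>i. y $ i > 0"
  shows "Phi g (fst (M1 (y, exchange_matrix))) = Phi_poly (D1 g) y"
proof -
  define x where "x = (\<lambda>i. sqrt (y $ i))"
  define s where "s = sqrt (1 + y$2 + y$2 * y$3)"
  define t where "t = sqrt (1 + y$3)"
  define z where "z = fst (M1 (y, exchange_matrix))"
  have x: "sqrt (y $ i) = x i" for i by (simp add: x_def)
  have y: "y $ i = (x i)\<^sup>2" for i using pos[of i] by (simp add: x_def less_imp_le)
  have s_sq: "s\<^sup>2 = 1 + (x 2)\<^sup>2 * (1 + (x 3)\<^sup>2)" and t_sq: "t\<^sup>2 = 1 + (x 3)\<^sup>2"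
    using pos[of 2] pos[of 3]
    by (simp_all add: s_def t_def less_imp_le algebra_simps flip: y)
  have st: "s > 0" "t > 0"
    unfolding s_def t_def using pos[of 2] pos[of 3] by (auto intro!: add_pos_pos)
  have nz: "x i \<noteq> 0" "s \<noteq> 0" "t \<noteq> 0" for i using pos[of i] st by (auto simp: x_def)
  \<comment> \<open>Both forms are needed to eliminate squares inside products associated to the right.\<close>
  have ss: "s * s = 1 + (x 2)\<^sup>2 * (1 + (x 3)\<^sup>2)"
      "s * (s * w) = (1 + (x 2)\<^sup>2 * (1 + (x 3)\<^sup>2)) * w"
    and tt: "t * t = 1 + (x 3)\<^sup>2" "t * (t * w) = (1 + (x 3)\<^sup>2) * w" for w
    using s_sq t_sq by (simp_all add: power2_eq_square flip: mult.assoc)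
  have z:
    "sqrt (z$1) = x 1 * x 2 * x 3 / s" "sqrt (z$2) = s / x 3" "sqrt (z$3) = t * s * x 5"
    "sqrt (z$4) = x 2 * t * x 4 / s" "sqrt (z$5) = 1 / (x 2 * t)" "sqrt (z$6) = x 3 * x 6 / t"
    by (simp_all add: z_def M1_seed[OF pos] x_def s_def t_def real_sqrt_mult real_sqrt_divide)
  \<comment> \<open>The only product of variables that \<open>Phi\<close> uses outside a square root, in \<open>Phi B2\<close>.\<close>
  have z12: "z $ 1 * z $ 2 = y $ 1 * y $ 2"
    using pos[of 3] st by (simp add: z_def M1_seed[OF pos] s_def)
  note expand = Phi_poly_X Phi_poly_diff Phi_poly_mult real_sqrt_mult real_sqrt_divide x z
  show ?thesis
    unfolding z_def[symmetric]
    by (induct g; simp add: expand z12;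
        simp add: divide_simps nz mult_ac; (simp add: ss tt)?; algebra?)
qed

section \<open>Permutations of the vertices\<close>

definition permute :: "('n::finite \<Rightarrow> 'n) \<Rightarrow> 'n seed \<Rightarrow> 'n seed" where
  "permute p = (\<lambda>(y, B). (\<chi> i. y $ p i, \<chi> i j. B $ p i $ p j))"

lemma mutation_permute:
  assumes "inj p"
  shows "mutation k (permute p s) = permute p (mutation (p k) s)"
  by (cases s) (simp add: mutation_def permute_def vec_eq_iff inj_eq[OF assms])

lemma relabel_permute:
  assumes "inj p"
  shows "relabel i j (permute p s) = permute p (relabel (p i) (p j) s)"
proof -
  have "p (Transposition.transpose i j k) = Transposition.transpose (p i) (p j) (p k)" for k
    by (simp add: Transposition.transpose_def inj_eq[OF assms])
  then show ?thesis
    by (cases s) (simp add: relabel_def permute_def)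
qed

lemma relabel_commute: "relabel i j = relabel j i"
  by (simp add: relabel_def Transposition.transpose_commute)

lemma inj_permute:
  assumes "surj p"
  shows "inj (permute p)"
proof (rule injI)
  fix s s' assume "permute p s = permute p s'"
  then have "fst s $ p i = fst s' $ p i" "snd s $ p i $ p j = snd s' $ p i $ p j" for i j
    by (auto simp: permute_def vec_eq_iff split: prod.splits)
  then have "fst s $ i = fst s' $ i" "snd s $ i $ j = snd s' $ i $ j" for i j
    by (metis assms surjD)+
  then show "s = s'" by (simp add: prod_eq_iff vec_eq_iff)
qed

section \<open>The fourfold symmetry\<close>

text \<open>
  This permutation is found by matching the vertex sequence \<open>2, 3, 2\<close> with relabeling \<open>3, 5\<close> of \<open>M1\<close>
  to the sequence \<open>1, 6, 1\<close> with relabeling \<open>6, 3\<close> of \<open>M2\<close>; the invariance of the exchange matrix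
  then determines the images of the remaining vertices. It matches \<open>M2\<close> to \<open>M3\<close> as well.
\<close>

definition rot :: "6 \<Rightarrow> 6" where
  "rot i = vector [2, 1, 6, 5, 3, 4] $ i"

lemma rot_simps [simp]:
  "rot 1 = 2" "rot 2 = 1" "rot 3 = 6" "rot 4 = 5" "rot 5 = 3" "rot 6 = 4"
  by (simp_all add: rot_def)

lemma surj_rot: "surj rot"
proof (rule surjI)
  show "rot (vector [2, 1, 5, 6, 4, 3] $ i) = i" for i
    using exhaust_6[of i] by auto
qed

lemma inj_rot: "inj rot"
  using finite_UNIV_surj_inj[OF finite surj_rot] .

lemma permute_rot_exchange_matrix:
  "permute rot (y, exchange_matrix) = (\<chi> i. y $ rot i, exchange_matrix)"
  unfolding prod_eq_iff vec_eq_iff forall_6 exchange_matrix_def by (simp add: permute_def)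

lemma M1_permute_rot: "M1 (permute rot s) = permute rot (M2 s)"
  by (simp add: M1_def M2_def mutation_permute relabel_permute inj_rot
      relabel_commute[of 6 3])

lemma M2_permute_rot: "M2 (permute rot s) = permute rot (M3 s)"
  by (simp add: M2_def M3_def mutation_permute relabel_permute inj_rot
      relabel_commute[of 6 4])

text \<open>
  The formula for each of \<open>K1, K2, K3, K123\<close> is a chain in three variables, in the orders
  \<open>(5, 2, 3)\<close>, \<open>(3, 1, 6)\<close>, \<open>(6, 2, 4)\<close>, \<open>(4, 1, 5)\<close>, and \<open>rot\<close> maps each triple to the next.
\<close>

fun rot_gen :: "gen \<Rightarrow> gen" where
  "rot_gen K1 = K2"
| "rot_gen K2 = K3"
| "rot_gen K3 = K123"
| "rot_gen K123 = K1"
| "rot_gen K12 = K23"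
| "rot_gen K23 = K12"
| "rot_gen B1 = B1"
| "rot_gen B2 = B2"

lemma surj_rot_gen: "surj rot_gen"
proof (rule surjI)
  show "rot_gen (rot_gen (rot_gen (rot_gen g))) = g" for g
    by (cases g) simp_all
qed

lemma Phi_rot: "Phi g (\<chi> i. y $ rot i) = Phi (rot_gen g) y"
  by (cases g) (simp_all add: mult_ac)

lemma Phi_poly_D1_rot: "Phi_poly (D1 g) (\<chi> i. y $ rot i) = Phi_poly (D2 (rot_gen g)) y"
  by (cases g) (simp_all only: D1.simps D2.simps rot_gen.simps
      Phi_poly_X Phi_poly_diff Phi_poly_mult Phi_rot)

lemma Phi_poly_D2_rot: "Phi_poly (D2 g) (\<chi> i. y $ rot i) = Phi_poly (D3 (rot_gen g)) y"
  by (cases g) (simp_all only: D2.simps D3.simps rot_gen.simps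
      Phi_poly_X Phi_poly_diff Phi_poly_mult Phi_rot)

text \<open>
  Comparing the two seeds after \<open>permute rot\<close>, which is injective, reduces \<open>M2\<close> to \<open>M1\<close> at permuted
  variables; \<open>M3\<close> is reduced to \<open>M2\<close> in the same way.
\<close>

lemma M2_seed:
  fixes y :: "real^6"
  assumes pos: "\<And>i. y $ i > 0"
  shows "M2 (y, exchange_matrix) = (vector
       [(1 + y$1 + y$1 * y$6) / y$6,
        y$1 * y$2 * y$6 / (1 + y$1 + y$1 * y$6),
        1 / (y$1 * (1 + y$6)),
        y$4 * y$6 / (1 + y$6),
        y$1 * y$5 * (1 + y$6) / (1 + y$1 + y$1 * y$6),
        y$3 * (1 + y$6) * (1 + y$1 + y$1 * y$6)], exchange_matrix)" (is "_ = ?seed")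
proof -
  have "permute rot (M2 (y, exchange_matrix)) = M1 (\<chi> i. y $ rot i, exchange_matrix)"
    by (simp add: M1_permute_rot flip: permute_rot_exchange_matrix)
  also have "\<dots> = permute rot ?seed"
    using pos by (simp add: M1_seed permute_rot_exchange_matrix vec_eq_iff forall_6 mult_ac)
  finally show ?thesis
    by (rule injD[OF inj_permute[OF surj_rot]])
qed

lemma M3_seed:
  fixes y :: "real^6"
  assumes pos: "\<And>i. y $ i > 0"
  shows "M3 (y, exchange_matrix) = (vector
       [y$1 * y$2 * y$4 / (1 + y$2 + y$2 * y$4),
        (1 + y$2 + y$2 * y$4) / y$4,
        y$2 * y$3 * (1 + y$4) / (1 + y$2 + y$2 * y$4),
        (1 + y$4) * (1 + y$2 + y$2 * y$4) * y$6,
        y$4 * y$5 / (1 + y$4),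
        1 / (y$2 * (1 + y$4))], exchange_matrix)" (is "_ = ?seed")
proof -
  have "permute rot (M3 (y, exchange_matrix)) = M2 (\<chi> i. y $ rot i, exchange_matrix)"
    by (simp add: M2_permute_rot flip: permute_rot_exchange_matrix)
  also have "\<dots> = permute rot ?seed"
    using pos by (simp add: M2_seed permute_rot_exchange_matrix vec_eq_iff forall_6 mult_ac)
  finally show ?thesis
    by (rule injD[OF inj_permute[OF surj_rot]])
qed

lemma Phi_permute_rot: "Phi g (fst (permute rot s)) = Phi (rot_gen g) (fst s)"
  by (cases s) (simp add: permute_def Phi_rot)

lemma Phi_M2:
  fixes y :: "real^6"
  assumes pos: "\<And>i. y $ i > 0"
  shows "Phi g (fst (M2 (y, exchange_matrix))) = Phi_poly (D2 g) y"
proof -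
  obtain h where g: "g = rot_gen h" by (rule surjE[OF surj_rot_gen])
  have "Phi g (fst (M2 (y, exchange_matrix)))
      = Phi h (fst (M1 (\<chi> i. y $ rot i, exchange_matrix)))"
    by (simp add: g M1_permute_rot Phi_permute_rot flip: permute_rot_exchange_matrix)
  also have "\<dots> = Phi_poly (D2 g) y"
    using pos by (simp add: g Phi_M1 Phi_poly_D1_rot)
  finally show ?thesis .
qed

lemma Phi_M3:
  fixes y :: "real^6"
  assumes pos: "\<And>i. y $ i > 0"
  shows "Phi g (fst (M3 (y, exchange_matrix))) = Phi_poly (D3 g) y"
proof -
  obtain h where g: "g = rot_gen h" by (rule surjE[OF surj_rot_gen])
  have "Phi g (fst (M3 (y, exchange_matrix)))
      = Phi h (fst (M2 (\<chi> i. y $ rot i, exchange_matrix)))"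
    by (simp add: g M2_permute_rot Phi_permute_rot flip: permute_rot_exchange_matrix)
  also have "\<dots> = Phi_poly (D3 g) y"
    using pos by (simp add: g Phi_M2 Phi_poly_D2_rot)
  finally show ?thesis .
qed

theorem mainTheorem3:
  fixes y :: "real^6"
  assumes pos: "\<And>i. y $ i > 0"
  shows
    "(snd (M1 (y, exchange_matrix)) = exchange_matrix \<and>
      snd (M2 (y, exchange_matrix)) = exchange_matrix \<and>
      snd (M3 (y, exchange_matrix)) = exchange_matrix) \<and>
     fst (M1 (y, exchange_matrix)) = vector
       [y$1 * y$2 * y$3 / (1 + y$2 + y$2 * y$3),
        (1 + y$2 + y$2 * y$3) / y$3,
        (1 + y$3) * (1 + y$2 + y$2 * y$3) * y$5,
        y$2 * (1 + y$3) * y$4 / (1 + y$2 + y$2 * y$3),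
        1 / (y$2 * (1 + y$3)),
        y$3 * y$6 / (1 + y$3)] \<and>
     fst (M2 (y, exchange_matrix)) = vector
       [(1 + y$1 + y$1 * y$6) / y$6,
        y$1 * y$2 * y$6 / (1 + y$1 + y$1 * y$6),
        1 / (y$1 * (1 + y$6)),
        y$4 * y$6 / (1 + y$6),
        y$1 * y$5 * (1 + y$6) / (1 + y$1 + y$1 * y$6),
        y$3 * (1 + y$6) * (1 + y$1 + y$1 * y$6)] \<and>
     fst (M3 (y, exchange_matrix)) = vector
       [y$1 * y$2 * y$4 / (1 + y$2 + y$2 * y$4),
        (1 + y$2 + y$2 * y$4) / y$4,
        y$2 * y$3 * (1 + y$4) / (1 + y$2 + y$2 * y$4),
        (1 + y$4) * (1 + y$2 + y$2 * y$4) * y$6,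
        y$4 * y$5 / (1 + y$4),
        1 / (y$2 * (1 + y$4))] \<and>
     (\<forall>g. Phi g (fst (M1 (y, exchange_matrix))) = Phi_poly (D1 g) y) \<and>
     (\<forall>g. Phi g (fst (M2 (y, exchange_matrix))) = Phi_poly (D2 g) y) \<and>
     (\<forall>g. Phi g (fst (M3 (y, exchange_matrix))) = Phi_poly (D3 g) y)"
  using M1_seed[OF pos] M2_seed[OF pos] M3_seed[OF pos]
    Phi_M1[OF pos] Phi_M2[OF pos] Phi_M3[OF pos]
  by simp

end
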